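(* Let $f: \mathbb{Z}^+ \to \mathbb{Z}_{\ge 0}$, and consider the adversarial burning game in which Builder adds $f(n)$ vertices on turn $n$. Then: (i) Arsonist has a winning strategy if there exists a real number $\alpha < 1$ such that $f(n) = O(n^\alpha)$ and $f(n)=\omega(n^{2\alpha-1})$; and (ii) Builder has a winning strategy if $f(n) = \Omega(n)$.
   Context: Adversarial burning game. Let $f:\mathbb{Z}^+\to\mathbb{Z}_{\ge 0}$ be a function known to both players, Builder and Arsonist. All graphs are finite and simple. The game starts with the empty graph $G_0$ (no vertices) and the empty set of burning vertices $B_0=\emptyset$. A vertex is either burning or unburned; burning vertices stay burning forever. At time step (turn) $n\ge 1$, in this order: (1) Builder adds $f(n)$ new (unburned) vertices to $G_{n-1}$, together with edges each of which is incident to at least one of these new vertices (joining two new vertices, or a new vertex and an old vertex), so that the resulting graph $G_n$ is connected (the graph with no vertices is allowed while no vertex has been added). Thus $G_{n-1}$ is the subgraph of $G_n$ induced by $V(G_{n-1})$. (2) The fire spreads: every vertex of $G_n$ adjacent in $G_n$ to a vertex of $B_{n-1}$ becomes burning. (3) Arsonist selects a fire source $v_n$, a vertex of $G_n$ that is still unburned, and it becomes burning; if $G_n$ has no unburned vertex, no fire source is selected at this step. Let $V_n=V(G_n)$ and let $B_n\subseteq V_n$ be the set of vertices burning at the end of step $n$. The game is played for all $n\in\mathbb{Z}^+$ with perfect information: each player's move may depend on the whole history of play so far. Writing $\mathbf{G}=(G_n)_{n\ge1}$ and $\mathbf{v}=(v_n)_{n\ge1}$, define $$\underline{\delta}(\mathbf{G},\mathbf{v})=\liminf_{n\to\infty}\frac{|B_n|}{|V_n|},\qquad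 \overline{\delta}(\mathbf{G},\mathbf{v})=\limsup_{n\to\infty}\frac{|B_n|}{|V_n|},$$ and $\delta(\mathbf{G},\mathbf{v})=\lim_{n\to\infty}|B_n|/|V_n|$ if this limit exists (only the $n$ with $V_n\neq\emptyset$ are considered). Arsonist wins if $\delta(\mathbf{G},\mathbf{v})$ exists and equals $1$. Builder wins if $\overline{\delta}(\mathbf{G},\mathbf{v})<1$. Otherwise (that is, $\overline{\delta}=1$ but $\underline{\delta}<1$) the game is a draw. A winning strategy for a player is a strategy which guarantees that this player wins whatever the other player does. Asymptotic notation (as $n\to\infty$, for positive $g$): $f(n)=O(g(n))$ means there are $c>0$ and $n_0$ with $f(n)\le c\,g(n)$ for all $n\ge n_0$; $f(n)=\Omega(g(n))$ means there are $c>0$ and $n_0$ with $f(n)\ge c\,g(n)$ for all $n\ge n_0$; $f(n)=\omega(g(n))$ means that for every $M>0$ there is $n_0$ with $f(n)\ge M g(n)$ for all $n\ge n_0$. *)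

theory Defs
  imports
    "Graph_Theory.Digraph_Component"
    "HOL-Library.Landau_Symbols"
    "HOL-Library.Extended_Real"
begin

text \<open>
  A finite simple graph is a \<open>pair_graph\<close>: a finite, loop-free digraph with a symmetric arc
  relation.  Vertices are natural numbers; these are mere names, and Builder may use any fresh ones.
  A play is a pair of sequences \<open>G\<close>, \<open>v\<close>, where \<open>G n\<close> is the graph after Builder's move at
  step \<open>n\<close> (with \<open>G 0\<close> empty) and \<open>v n\<close> is the fire source selected at step \<open>n\<close>
  (\<open>None\<close> if there is none; \<open>v 0\<close> is irrelevant).
\<close>

type_synonym ugraph = "nat pair_pre_digraph"

definition empty_ugraph :: ugraph where
  "empty_ugraph = \<lparr> pverts = {}, parcs = {} \<rparr>"

text \<open>The library's \<open>connected\<close> excludes the graph without vertices, which the game allows.\<close>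

definition builder_move :: "nat \<Rightarrow> ugraph \<Rightarrow> ugraph \<Rightarrow> bool" where
  "builder_move k G G' \<longleftrightarrow>
     pair_graph G' \<and>
     pverts G \<subseteq> pverts G' \<and> card (pverts G' - pverts G) = k \<and>
     parcs G \<subseteq> parcs G' \<and>
     (\<forall>(x, y) \<in> parcs G' - parcs G. x \<notin> pverts G \<or> y \<notin> pverts G) \<and>
     (pverts G' = {} \<or> Digraph_Component.connected (with_proj G'))"

definition spread :: "ugraph \<Rightarrow> nat set \<Rightarrow> nat set" where
  "spread G B = B \<union> {w \<in> pverts G. \<exists>u \<in> B. (u, w) \<in> parcs G}"

primrec burning :: "(nat \<Rightarrow> ugraph) \<Rightarrow> (nat \<Rightarrow> nat option) \<Rightarrow> nat \<Rightarrow> nat set" where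
  "burning G v 0 = {}"
| "burning G v (Suc n) = spread (G (Suc n)) (burning G v n) \<union> set_option (v (Suc n))"

definition arsonist_move :: "nat set \<Rightarrow> nat option \<Rightarrow> bool" where
  "arsonist_move U s \<longleftrightarrow> (if U = {} then s = None else (\<exists>x \<in> U. s = Some x))"

definition builder_legal :: "(nat \<Rightarrow> nat) \<Rightarrow> (nat \<Rightarrow> ugraph) \<Rightarrow> bool" where
  "builder_legal f G \<longleftrightarrow> (\<forall>n \<ge> 1. builder_move (f n) (G (n - 1)) (G n))"

definition arsonist_legal :: "(nat \<Rightarrow> ugraph) \<Rightarrow> (nat \<Rightarrow> nat option) \<Rightarrow> bool" where
  "arsonist_legal G v \<longleftrightarrow>
     (\<forall>n \<ge> 1. arsonist_move (pverts (G n) - spread (G n) (burning G v (n - 1))) (v n))"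

text \<open>
  If \<open>G n\<close> has no vertices, the ratio below is \<open>0 / 0 = 0\<close>.  Unless \<open>f\<close> vanishes on all
  positive integers, this affects only finitely many \<open>n\<close> and hence no limit.
\<close>

definition burning_ratio :: "(nat \<Rightarrow> ugraph) \<Rightarrow> (nat \<Rightarrow> nat option) \<Rightarrow> nat \<Rightarrow> real" where
  "burning_ratio G v n = real (card (burning G v n)) / real (card (pverts (G n)))"

definition upper_density :: "(nat \<Rightarrow> ugraph) \<Rightarrow> (nat \<Rightarrow> nat option) \<Rightarrow> ereal" where
  "upper_density G v = limsup (\<lambda>n. ereal (burning_ratio G v n))"

definition arsonist_wins :: "(nat \<Rightarrow> ugraph) \<Rightarrow> (nat \<Rightarrow> nat option) \<Rightarrow> bool" where
  "arsonist_wins G v \<longleftrightarrow> burning_ratio G v \<longlonglongrightarrow> 1"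

definition builder_wins :: "(nat \<Rightarrow> ugraph) \<Rightarrow> (nat \<Rightarrow> nat option) \<Rightarrow> bool" where
  "builder_wins G v \<longleftrightarrow> upper_density G v < 1"

text \<open>
  A strategy maps the history to the next move.  At step \<open>n\<close> the history consists of
  \<open>G 1, \<dots>, G (n - 1)\<close> and \<open>v 1, \<dots>, v (n - 1)\<close>, and for Arsonist also of \<open>G n\<close>;
  the step number is determined by the lengths of the lists.
\<close>

type_synonym builder_strategy = "ugraph list \<Rightarrow> nat option list \<Rightarrow> ugraph"
type_synonym arsonist_strategy = "ugraph list \<Rightarrow> nat option list \<Rightarrow> nat option"

definition follows_builder ::
    "builder_strategy \<Rightarrow> (nat \<Rightarrow> ugraph) \<Rightarrow> (nat \<Rightarrow> nat option) \<Rightarrow> bool" where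
  "follows_builder \<sigma> G v \<longleftrightarrow> (\<forall>n \<ge> 1. G n = \<sigma> (map G [1..<n]) (map v [1..<n]))"

definition follows_arsonist ::
    "arsonist_strategy \<Rightarrow> (nat \<Rightarrow> ugraph) \<Rightarrow> (nat \<Rightarrow> nat option) \<Rightarrow> bool" where
  "follows_arsonist \<tau> G v \<longleftrightarrow> (\<forall>n \<ge> 1. v n = \<tau> (map G [1..<Suc n]) (map v [1..<n]))"

text \<open>
  A winning strategy must itself prescribe legal moves, so legality of its owner's moves is part of
  the conclusion, while legality of the opponent's moves is assumed.  The opponent always has a
  legal move as long as the owner has played legally, so no strategy wins vacuously.
\<close>

definition builder_winning_strategy :: "(nat \<Rightarrow> nat) \<Rightarrow> builder_strategy \<Rightarrow> bool" where
  "builder_winning_strategy f \<sigma> \<longleftrightarrow>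
     (\<forall>G v. G 0 = empty_ugraph \<and> follows_builder \<sigma> G v \<and> arsonist_legal G v \<longrightarrow>
        builder_legal f G \<and> builder_wins G v)"

definition arsonist_winning_strategy :: "(nat \<Rightarrow> nat) \<Rightarrow> arsonist_strategy \<Rightarrow> bool" where
  "arsonist_winning_strategy f \<tau> \<longleftrightarrow>
     (\<forall>G v. G 0 = empty_ugraph \<and> follows_arsonist \<tau> G v \<and> builder_legal f G \<longrightarrow>
        arsonist_legal G v \<and> arsonist_wins G v)"

end

theory Submission
  imports Defs
begin

text \<open>
  Write \<open>N\<close> for the number of vertices after turn \<open>n\<close>.

  Arsonist's half rests on the fact that a connected graph with \<open>N\<close> vertices can be burned completely
  in \<open>O(\<surd>N)\<close> turns.  Arsonist plays greedily: the source is an unburned vertex as far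
  as possible from the fire.  If some vertex that existed at turn \<open>n - 4t\<close> is still unburned at
  turn \<open>n\<close>, then each source chosen during \<open>[n - 4t, n - 2t]\<close> was at least as far from the fire as
  that vertex, so the balls of radius \<open>t\<close> around these sources are disjoint; each has more than
  \<open>t\<close> vertices because the graph is connected and not filled by the ball, and so
  \<open>2t\<^sup>2 < N\<close>.  These balls are taken in
  the graph at the turn when their centre is chosen: later turns may add shortcuts, but a shortcut
  enlarges only what the older balls reach, which the newer source also avoids
  (\<open>old_vertices_burned\<close>).  With \<open>t \<approx> \<surd>N\<close> the unburned vertices are among those added
  during the last \<open>O(\<surd>N)\<close> turns, of which there are \<open>O(\<surd>N n\<^sup>\<alpha>)\<close>.  This
  is \<open>o(N)\<close> exactly when \<open>N = \<omega>(n\<^sup>2\<^sup>\<alpha>)\<close>, and that is what the lower bound on \<open>f\<close>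
  gives by summation (\<open>recent_vertices_negligible\<close>).

  Builder's half: suppose \<open>f n \<ge> c n\<close> for large \<open>n\<close>.  Builder extends one path at its end.  During the last \<open>T\<close> turns the fire in
  the old part advances by at most \<open>T\<close> vertices into the new part, and the new sources burn at most
  \<open>2T\<^sup>2\<close> vertices (\<open>card_burning_path_le\<close>).  The whole game is the case \<open>T = n\<close>, so at most
  \<open>3n\<^sup>2\<close> vertices burn by turn \<open>n\<close>; this settles the turns with \<open>N \<ge> 6n\<^sup>2\<close>.  If \<open>N < 6n\<^sup>2\<close>, take
  \<open>T\<close> to be a small multiple of \<open>n\<close>: at least about \<open>c n T\<close> vertices have been added during these
  turns, which exceeds \<open>2T\<^sup>2 + T\<close> by a constant fraction of \<open>n\<^sup>2\<close>, hence of \<open>N\<close>.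
\<close>

section \<open>Spreading fire and balls in a graph\<close>

text \<open>The iterate \<open>(spread G ^^ k) A\<close> is the set of vertices at distance at most \<open>k\<close> from \<open>A\<close>.\<close>

lemma mem_spread_iff:
  "w \<in> spread G A \<longleftrightarrow> w \<in> A \<or> w \<in> pverts G \<and> (\<exists>u\<in>A. (u, w) \<in> parcs G)"
  by (auto simp: spread_def)

lemma spread_mono: "A \<subseteq> B \<Longrightarrow> spread G A \<subseteq> spread G B"
  by (auto simp: spread_def)

lemma subset_spread: "A \<subseteq> spread G A"
  by (auto simp: spread_def)

lemma spread_subset_pverts: "A \<subseteq> pverts G \<Longrightarrow> spread G A \<subseteq> pverts G"
  by (auto simp: spread_def)

lemma funpow_spread_mono: "A \<subseteq> B \<Longrightarrow> (spread G ^^ k) A \<subseteq> (spread G ^^ k) B"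
  by (induction k) (auto dest: spread_mono)

lemma funpow_spread_mono_radius:
  assumes "j \<le> k"
  shows "(spread G ^^ j) A \<subseteq> (spread G ^^ k) A"
  using assms by (induction k rule: dec_induct) (use subset_spread in force)+

lemma funpow_spread_mono_graph:
  assumes "pverts G \<subseteq> pverts H" "parcs G \<subseteq> parcs H"
  shows "(spread G ^^ k) A \<subseteq> (spread H ^^ k) A"
proof (induction k)
  case (Suc k)
  have "spread G X \<subseteq> spread H Y" if "X \<subseteq> Y" for X Y
    using that assms by (auto simp: spread_def)
  with Suc show ?case by simp
qed simp

lemma funpow_spread_subset_pverts: "A \<subseteq> pverts G \<Longrightarrow> (spread G ^^ k) A \<subseteq> pverts G"
  by (induction k) (auto dest: spread_subset_pverts)

lemma funpow_spread_commute:
  assumes "pair_graph G" "w \<in> (spread G ^^ k) {u}"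
  shows "u \<in> (spread G ^^ k) {w}"
  using assms(2)
proof (induction k arbitrary: w)
  case (Suc k)
  interpret pair_graph G by fact
  from Suc.prems obtain z where z: "z \<in> (spread G ^^ k) {u}" "w = z \<or> (z, w) \<in> parcs G"
    by (auto simp: mem_spread_iff)
  have "z \<in> spread G {w}"
    using z(2) arcs_symmetric[of z w] arc_fst_in_verts[of "(z, w)"] by (auto simp: spread_def)
  then have "(spread G ^^ k) {z} \<subseteq> (spread G ^^ k) (spread G {w})"
    by (intro funpow_spread_mono) auto
  with Suc.IH[OF z(1)] show ?case by (auto simp: funpow_swap1)
qed simp

lemma funpow_spread_triangle:
  assumes "pair_graph G" "y \<in> (spread G ^^ j) {u}" "y \<in> (spread G ^^ k) {w}"
  shows "w \<in> (spread G ^^ (k + j)) {u}"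
proof -
  have "w \<in> (spread G ^^ k) {y}"
    using assms by (auto intro: funpow_spread_commute)
  also have "\<dots> \<subseteq> (spread G ^^ k) ((spread G ^^ j) {u})"
    using assms(2) by (intro funpow_spread_mono) auto
  finally show ?thesis by (simp add: funpow_add)
qed

lemma spread_closed_imp_pverts:
  assumes "pair_graph G" and conn: "Digraph_Component.connected (with_proj G)"
    and closed: "spread G A \<subseteq> A" and A: "A \<subseteq> pverts G" "u \<in> A"
  shows "A = pverts G"
proof -
  interpret pair_graph G by fact
  have "w \<in> A" if "w \<in> pverts G" for w
  proof -
    have "(u, w) \<in> rtrancl_on (pverts G) ((parcs G)\<^sup>s)"
      using conn that A by (auto simp: connected_conv)
    moreover have "(parcs G)\<^sup>s = parcs G"
      using arcs_symmetric by (auto simp: symcl_def)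
    ultimately have "(u, w) \<in> rtrancl_on (pverts G) (parcs G)" by simp
    then show ?thesis
      by (induction rule: rtrancl_on_induct) (use A closed in \<open>auto simp: spread_def\<close>)
  qed
  with A show ?thesis by blast
qed

text \<open>Until a ball fills the connected graph, each increase of the radius adds a vertex.\<close>

lemma card_ball_gt_radius:
  assumes G: "pair_graph G" and conn: "Digraph_Component.connected (with_proj G)"
    and u: "u \<in> pverts G" and ne: "(spread G ^^ k) {u} \<noteq> pverts G"
  shows "k < card ((spread G ^^ k) {u})"
  using ne
proof (induction k)
  case (Suc k)
  let ?B = "(spread G ^^ k) {u}"
  interpret pair_graph G by fact
  have sub: "?B \<subseteq> pverts G"
    using u by (intro funpow_spread_subset_pverts) auto
  have "?B \<noteq> pverts G"
  proof
    assume "?B = pverts G"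
    then have "spread G ?B = pverts G"
      using subset_spread spread_subset_pverts by (metis order_refl subset_antisym)
    with Suc.prems show False by simp
  qed
  then have "k < card ?B" and not_closed: "\<not> spread G ?B \<subseteq> ?B"
    using Suc.IH spread_closed_imp_pverts[OF G conn _ sub, of u]
      funpow_spread_mono_radius[of 0 k G "{u}"] by auto
  moreover have "card ?B < card (spread G ?B)"
  proof (rule psubset_card_mono)
    show "finite (spread G ?B)"
      using spread_subset_pverts[OF sub] pair_finite_verts finite_subset by blast
    show "?B \<subset> spread G ?B" using not_closed subset_spread by blast
  qed
  ultimately show ?case by simp
qed simp

section \<open>Legal plays\<close>

lemma builder_legal_step:
  assumes "builder_legal f G"
  shows "builder_move (f (Suc n)) (G n) (G (Suc n))"
  using assms unfolding builder_legal_def by (metis diff_Suc_1 le_add1 plus_1_eq_Suc)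

lemma builder_legal_mono:
  assumes "builder_legal f G" "m \<le> n"
  shows "pverts (G m) \<subseteq> pverts (G n)" "parcs (G m) \<subseteq> parcs (G n)"
  using assms(2)
  by (induction n rule: dec_induct)
    (use builder_legal_step[OF assms(1)] in \<open>force simp: builder_move_def\<close>)+

lemma builder_legal_graph:
  assumes "builder_legal f G" "1 \<le> n"
  shows "pair_graph (G n)"
    "pverts (G n) \<noteq> {} \<Longrightarrow> Digraph_Component.connected (with_proj (G n))"
  using assms by (auto simp: builder_legal_def builder_move_def)

lemma finite_pverts:
  assumes "G 0 = empty_ugraph" "builder_legal f G"
  shows "finite (pverts (G n))"
proof (cases n)
  case 0
  with assms show ?thesis by (simp add: empty_ugraph_def)
next
  case (Suc m)
  interpret pair_graph "G n" using assms Suc by (intro builder_legal_graph) auto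
  show ?thesis by (rule pair_finite_verts)
qed

lemma card_pverts:
  assumes "G 0 = empty_ugraph" "builder_legal f G"
  shows "card (pverts (G n)) = sum f {1..n}"
proof (induction n)
  case 0
  with assms show ?case by (simp add: empty_ugraph_def)
next
  case (Suc n)
  have new: "card (pverts (G (Suc n)) - pverts (G n)) = f (Suc n)"
    and sub: "pverts (G n) \<subseteq> pverts (G (Suc n))"
    using builder_legal_step[OF assms(2), of n] by (auto simp: builder_move_def)
  have "card (pverts (G n)) \<le> card (pverts (G (Suc n)))"
    using sub finite_pverts[OF assms] by (rule card_mono[rotated])
  with card_Diff_subset[OF finite_pverts[OF assms] sub] new Suc show ?case by simp
qed

lemma sum_split_turn:
  fixes f :: "nat \<Rightarrow> nat"
  assumes "m \<le> n"
  shows "sum f {1..n} = sum f {1..m} + sum f {m<..n}"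
proof -
  have "{1..n} = {1..m} \<union> {m<..n}" using assms by auto
  moreover have "sum f ({1..m} \<union> {m<..n}) = sum f {1..m} + sum f {m<..n}"
    by (rule sum.union_disjoint) auto
  ultimately show ?thesis by simp
qed

lemma burning_cong:
  assumes "\<And>i. 1 \<le> i \<Longrightarrow> i \<le> n \<Longrightarrow> G i = H i" "\<And>i. 1 \<le> i \<Longrightarrow> i \<le> n \<Longrightarrow> v i = w i"
  shows "burning G v n = burning H w n"
  using assms by (induction n) auto

lemma burning_subset_pverts:
  assumes "\<And>n. pverts (G n) \<subseteq> pverts (G (Suc n))" "arsonist_legal G v"
  shows "burning G v n \<subseteq> pverts (G n)"
proof (induction n)
  case (Suc n)
  have "spread (G (Suc n)) (burning G v n) \<subseteq> pverts (G (Suc n))"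
    using Suc assms(1) by (intro spread_subset_pverts) blast
  moreover have "arsonist_move (pverts (G (Suc n)) - spread (G (Suc n)) (burning G v n)) (v (Suc n))"
    using assms(2) unfolding arsonist_legal_def by (metis diff_Suc_1 le_add1 plus_1_eq_Suc)
  ultimately show ?case
    by (auto simp: arsonist_move_def split: if_splits)
qed simp

text \<open>Builder never removes edges, so the fire spreads at least as fast as in an earlier graph.\<close>

lemma funpow_spread_burning_subset:
  assumes "builder_legal f G"
  shows "(spread (G m) ^^ k) (burning G v m) \<subseteq> burning G v (m + k)"
proof (induction k)
  case (Suc k)
  have "spread (G m) ((spread (G m) ^^ k) (burning G v m)) \<subseteq> spread (G m) (burning G v (m + k))"
    using Suc by (rule spread_mono)
  also have "\<dots> \<subseteq> spread (G (Suc (m + k))) (burning G v (m + k))"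
    using builder_legal_mono[OF assms, of m "Suc (m + k)"] by (auto simp: spread_def)
  finally show ?case by auto
qed simp

section \<open>The greedy strategy of Arsonist\<close>

text \<open>A vertex outside \<open>S\<close> at maximal distance from \<open>S\<close>, phrased by balls so that vertices
  that the fire cannot reach at all need no separate treatment.\<close>

definition farthest :: "ugraph \<Rightarrow> nat set \<Rightarrow> nat \<Rightarrow> bool" where
  "farthest G S x \<longleftrightarrow> x \<in> pverts G - S \<and>
     (\<forall>k. pverts G - (spread G ^^ k) S \<noteq> {} \<longrightarrow> x \<notin> (spread G ^^ k) S)"

lemma farthest_exists:
  assumes "finite (pverts G)" "pverts G - S \<noteq> {}"
  shows "\<exists>x. farthest G S x"
proof -
  define P where "P k = pverts G - (spread G ^^ k) S" for k
  have anti: "P k \<subseteq> P j" if "j \<le> k" for j k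
    using funpow_spread_mono_radius[OF that, of G S] by (auto simp: P_def)
  have "P 0 \<noteq> {}" using assms by (simp add: P_def)
  then obtain k where k: "P k \<noteq> {}" and min: "\<And>j. P j \<noteq> {} \<Longrightarrow> card (P k) \<le> card (P j)"
    using ex_has_least_nat[of "\<lambda>k. P k \<noteq> {}" 0 "\<lambda>k. card (P k)"] by blast
  have "P k \<subseteq> P j" if "P j \<noteq> {}" for j
  proof (cases "j \<le> k")
    case False
    have "P j = P k"
    proof (rule card_seteq)
      show "finite (P k)" using assms by (simp add: P_def)
      show "P j \<subseteq> P k" using False by (intro anti) auto
      show "card (P k) \<le> card (P j)" using that by (rule min)
    qed
    then show ?thesis by simp
  qed (rule anti)
  moreover obtain x where x: "x \<in> P k" using k by blast
  ultimately have "x \<in> P j" if "P j \<noteq> {}" for j using that by blast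
  moreover from this[OF \<open>P 0 \<noteq> {}\<close>] have "x \<in> pverts G - S" by (simp add: P_def)
  ultimately have "farthest G S x" unfolding farthest_def P_def by blast
  then show ?thesis ..
qed

definition greedy_choice :: "ugraph \<Rightarrow> nat set \<Rightarrow> nat option" where
  "greedy_choice G S = (if pverts G - S = {} then None else Some (SOME x. farthest G S x))"

lemma greedy_choice_farthest:
  assumes "finite (pverts G)" "pverts G - S \<noteq> {}"
  obtains x where "greedy_choice G S = Some x" "farthest G S x"
proof (rule that)
  show "greedy_choice G S = Some (SOME x. farthest G S x)"
    using assms(2) by (simp only: greedy_choice_def if_False)
  show "farthest G S (SOME x. farthest G S x)"
    by (rule someI_ex[OF farthest_exists[OF assms]])
qed

text \<open>The burning set is recomputed from the history; a history list holds the entry of step \<open>i\<close>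
  at position \<open>i - 1\<close>.\<close>

definition greedy_strategy :: arsonist_strategy where
  "greedy_strategy Gs vs = greedy_choice (last Gs)
     (spread (last Gs) (burning (\<lambda>i. Gs ! (i - 1)) (\<lambda>i. vs ! (i - 1)) (length vs)))"

lemma follows_greedy_strategyD:
  assumes "follows_arsonist greedy_strategy G v" "1 \<le> n"
  shows "v n = greedy_choice (G n) (spread (G n) (burning G v (n - 1)))"
proof -
  have "v n = greedy_strategy (map G [1..<Suc n]) (map v [1..<n])"
    using assms by (simp add: follows_arsonist_def)
  moreover have "burning (\<lambda>i. map G [1..<Suc n] ! (i - 1)) (\<lambda>i. map v [1..<n] ! (i - 1)) (n - 1)
      = burning G v (n - 1)"
    by (rule burning_cong) (use assms in \<open>auto simp: nth_append simp del: upt_Suc\<close>)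
  moreover have "last (map G [1..<Suc n]) = G n" using assms by simp
  moreover have "length (map v [1..<n]) = n - 1" by simp
  ultimately show ?thesis unfolding greedy_strategy_def by simp
qed

lemma greedy_strategy_legal:
  assumes "G 0 = empty_ugraph" "builder_legal f G" "follows_arsonist greedy_strategy G v"
  shows "arsonist_legal G v"
  unfolding arsonist_legal_def
proof (intro allI impI)
  fix n :: nat assume n: "1 \<le> n"
  let ?S = "spread (G n) (burning G v (n - 1))"
  show "arsonist_move (pverts (G n) - ?S) (v n)"
  proof (cases "pverts (G n) - ?S = {}")
    case True
    then show ?thesis
      using follows_greedy_strategyD[OF assms(3) n] by (simp add: arsonist_move_def greedy_choice_def)
  next
    case False
    with finite_pverts[OF assms(1,2), of n] obtain x
      where "greedy_choice (G n) ?S = Some x" "farthest (G n) ?S x"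
      by (rule greedy_choice_farthest)
    with False show ?thesis
      using follows_greedy_strategyD[OF assms(3) n] by (auto simp: arsonist_move_def farthest_def)
  qed
qed

text \<open>
  A vertex \<open>x\<close> that is old but unburned at step \<open>n\<close> was, at every earlier step \<open>m\<close>, at distance
  more than \<open>n - m\<close> from the fire; hence so was the source chosen at step \<open>m\<close>.  For
  \<open>m \<le> n - 2t\<close> that distance exceeds \<open>2t\<close>, so the \<open>t\<close>-ball around the source misses those of
  all earlier sources.
\<close>

lemma old_vertices_burned:
  assumes init: "G 0 = empty_ugraph" and legal: "builder_legal f G"
    and greedy: "follows_arsonist greedy_strategy G v"
    and n: "4 * t < n" and many: "card (pverts (G n)) \<le> 2 * t * t"
  shows "pverts (G (n - 4 * t)) \<subseteq> burning G v n"
proof (rule ccontr)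
  assume "\<not> ?thesis"
  then obtain x where x: "x \<in> pverts (G (n - 4 * t))" "x \<notin> burning G v n" by blast
  define M where "M = {n - 4 * t..n - 2 * t}"
  define S where "S m = spread (G m) (burning G v (m - 1))" for m
  have M: "1 \<le> m" "m \<le> n" "2 * t \<le> n - m" "n - 4 * t \<le> m" if "m \<in> M" for m
    using that n by (auto simp: M_def)
  have graph: "pair_graph (G m)" if "m \<in> M" for m
    using builder_legal_graph[OF legal M(1)[OF that]] by simp
  have burning_eq: "burning G v m = S m \<union> set_option (v m)" if "m \<in> M" for m
    using M(1)[OF that] by (cases m) (auto simp: S_def)
  have x_in: "x \<in> pverts (G m)" if "m \<in> M" for m
    using x(1) builder_legal_mono[OF legal M(4)[OF that]] by blast
  have x_far: "x \<notin> (spread (G m) ^^ (n - m)) (burning G v m)" if "m \<in> M" for m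
  proof -
    have "m + (n - m) = n" using M(2)[OF that] by simp
    then have "(spread (G m) ^^ (n - m)) (burning G v m) \<subseteq> burning G v n"
      using funpow_spread_burning_subset[OF legal, where m = m and k = "n - m" and v = v] by (simp only:)
    with x(2) show ?thesis by blast
  qed
  have x_far': "x \<notin> (spread (G m) ^^ (n - m)) (S m)" if "m \<in> M" for m
    using x_far[OF that] funpow_spread_mono[of "S m" "burning G v m"] burning_eq[OF that] by blast
  have "\<exists>s. v m = Some s \<and> farthest (G m) (S m) s" if "m \<in> M" for m
  proof -
    have "x \<notin> S m"
      using x_far'[OF that] funpow_spread_mono_radius[of 0 "n - m" "G m" "S m"] by auto
    then have "pverts (G m) - S m \<noteq> {}" using x_in[OF that] by blast
    with finite_pverts[OF init legal] obtain s
      where "greedy_choice (G m) (S m) = Some s" "farthest (G m) (S m) s"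
      by (rule greedy_choice_farthest)
    then show ?thesis
      using follows_greedy_strategyD[OF greedy M(1)[OF that]] by (simp add: S_def)
  qed
  then obtain s where s: "\<And>m. m \<in> M \<Longrightarrow> v m = Some (s m)"
    and far: "\<And>m. m \<in> M \<Longrightarrow> farthest (G m) (S m) (s m)"
    by metis
  have s_in: "s m \<in> pverts (G m)" if "m \<in> M" for m
    using far[OF that] by (auto simp: farthest_def)
  have s_far: "s m \<notin> (spread (G m) ^^ (2 * t)) (S m)" if "m \<in> M" for m
  proof -
    have "s m \<notin> (spread (G m) ^^ (n - m)) (S m)"
      using far[OF that] x_in[OF that] x_far'[OF that] by (auto simp: farthest_def)
    then show ?thesis
      using funpow_spread_mono_radius[OF M(3)[OF that]] by blast
  qed
  define ball where "ball m = (spread (G m) ^^ t) {s m}" for m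
  have ball_sub: "ball m \<subseteq> pverts (G n)" if "m \<in> M" for m
    using funpow_spread_subset_pverts[of "{s m}" "G m" t] s_in[OF that]
      builder_legal_mono(1)[OF legal M(2)[OF that]]
    by (auto simp: ball_def)
  have ball_card: "t < card (ball m)" if "m \<in> M" for m
    unfolding ball_def
  proof (rule card_ball_gt_radius[OF graph[OF that] _ s_in[OF that]])
    show "Digraph_Component.connected (with_proj (G m))"
      using builder_legal_graph(2)[OF legal M(1)[OF that]] s_in[OF that] by blast
    have "(spread (G m) ^^ t) {s m} \<subseteq> (spread (G m) ^^ (n - m)) {s m}"
      using M(3)[OF that] by (intro funpow_spread_mono_radius) simp
    also have "\<dots> \<subseteq> (spread (G m) ^^ (n - m)) (burning G v m)"
      using burning_eq[OF that] s[OF that] by (intro funpow_spread_mono) auto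
    finally show "(spread (G m) ^^ t) {s m} \<noteq> pverts (G m)"
      using x_far[OF that] x_in[OF that] by blast
  qed
  have disj: "ball i \<inter> ball j = {}" if ij: "i \<in> M" "j \<in> M" "i < j" for i j
  proof (rule ccontr)
    assume "ball i \<inter> ball j \<noteq> {}"
    then obtain y where y: "y \<in> ball i" "y \<in> ball j" by blast
    have "y \<in> (spread (G j) ^^ t) {s i}"
      using y(1) builder_legal_mono[OF legal, of i j] ij(3)
        funpow_spread_mono_graph[of "G i" "G j" t "{s i}"] by (auto simp: ball_def)
    then have "s j \<in> (spread (G j) ^^ (t + t)) {s i}"
      using y(2) graph[OF ij(2)] unfolding ball_def by (rule funpow_spread_triangle[rotated])
    moreover have "s i \<in> S j"
    proof -
      have "s i \<in> burning G v i" using burning_eq[OF ij(1)] s[OF ij(1)] by simp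
      moreover have "burning G v i \<subseteq> burning G v (j - 1)"
        using funpow_spread_burning_subset[OF legal, where m = i and k = "j - 1 - i" and v = v] ij(3)
          funpow_spread_mono_radius[of 0 "j - 1 - i" "G i" "burning G v i"] by simp
      ultimately show ?thesis using subset_spread by (auto simp: S_def)
    qed
    ultimately have "s j \<in> (spread (G j) ^^ (2 * t)) (S j)"
      using funpow_spread_mono[of "{s i}" "S j" "2 * t" "G j"] by (auto simp: mult_2)
    then show False using s_far[OF ij(2)] by blast
  qed
  have fin: "finite (ball m)" if "m \<in> M" for m
    using ball_sub[OF that] finite_pverts[OF init legal] finite_subset by blast
  have "(2 * t + 1) * (t + 1) = (\<Sum>m\<in>M. t + 1)"
    using n by (simp add: M_def)
  also have "\<dots> \<le> (\<Sum>m\<in>M. card (ball m))"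
    using ball_card by (intro sum_mono) (simp add: Suc_le_eq)
  also have "\<dots> = card (\<Union>m\<in>M. ball m)"
  proof (rule card_UN_disjoint[symmetric])
    show "\<forall>i\<in>M. \<forall>j\<in>M. i \<noteq> j \<longrightarrow> ball i \<inter> ball j = {}"
      using disj by (metis inf_commute linorder_neqE_nat)
  qed (use fin in \<open>auto simp: M_def\<close>)
  also have "\<dots> \<le> card (pverts (G n))"
    using ball_sub finite_pverts[OF init legal] by (intro card_mono) auto
  also note many
  finally show False by (simp add: algebra_simps)
qed

lemma card_unburned_le:
  assumes init: "G 0 = empty_ugraph" and legal: "builder_legal f G"
    and greedy: "follows_arsonist greedy_strategy G v"
    and n: "4 * t < n" and many: "sum f {1..n} \<le> 2 * t * t"
  shows "sum f {1..n} - card (burning G v n) \<le> sum f {n - 4 * t<..n}"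
proof -
  have "card (pverts (G (n - 4 * t))) \<le> card (burning G v n)"
  proof (rule card_mono)
    show "pverts (G (n - 4 * t)) \<subseteq> burning G v n"
      using many card_pverts[OF init legal] by (intro old_vertices_burned[OF init legal greedy n]) simp
    show "finite (burning G v n)"
      using burning_subset_pverts[OF _ greedy_strategy_legal[OF init legal greedy], of n]
        builder_legal_mono(1)[OF legal] finite_pverts[OF init legal] finite_subset
      by (metis le_add2 plus_1_eq_Suc)
  qed
  moreover have "sum f {1..n} = sum f {1..n - 4 * t} + sum f {n - 4 * t<..n}"
    by (rule sum_split_turn) simp
  ultimately show ?thesis using card_pverts[OF init legal] by simp
qed

section \<open>Growth of the number of vertices\<close>

text \<open>The second half of the summation range already gives the right order of magnitude, and there
  \<open>k\<close> may be replaced by \<open>n\<close> at the cost of a factor 2, since \<open>2 * \<alpha> - 1 \<le> 1\<close>.\<close>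

lemma eventually_sum_ge:
  fixes f :: "nat \<Rightarrow> nat" and \<alpha> M :: real
  assumes "\<alpha> < 1" and f: "(\<lambda>n. real (f n)) \<in> \<omega>(\<lambda>n. real n powr (2 * \<alpha> - 1))" and "M > 0"
  shows "\<forall>\<^sub>F n in sequentially. M * real n powr (2 * \<alpha>) \<le> real (sum f {1..n})"
proof -
  have "\<forall>\<^sub>F n in sequentially. norm (real (f n)) \<ge> (4 * M) * norm (real n powr (2 * \<alpha> - 1))"
    using f \<open>M > 0\<close> by (intro landau_omega.smallD) auto
  then obtain m where m: "\<And>k. k \<ge> m \<Longrightarrow> 4 * M * real k powr (2 * \<alpha> - 1) \<le> real (f k)"
    by (auto simp: eventually_sequentially)
  have "M * real n powr (2 * \<alpha>) \<le> real (sum f {1..n})" if n: "n \<ge> 2 * m + 1" for n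
  proof -
    have half: "real n powr (2 * \<alpha> - 1) / 2 \<le> real k powr (2 * \<alpha> - 1)"
      if k: "k \<in> {n div 2<..n}" for k
    proof (cases "2 * \<alpha> - 1 \<ge> 0")
      case True
      have "(1/2) powr 1 \<le> (1/2 :: real) powr (2 * \<alpha> - 1)"
        using \<open>\<alpha> < 1\<close> by (intro powr_mono') auto
      then have "real n powr (2 * \<alpha> - 1) / 2 \<le> real n powr (2 * \<alpha> - 1) * (1/2) powr (2 * \<alpha> - 1)"
        using mult_left_mono[of "1/2" "(1/2) powr (2 * \<alpha> - 1)" "real n powr (2 * \<alpha> - 1)"] by simp
      also have "\<dots> = (real n * (1/2)) powr (2 * \<alpha> - 1)"
        by (rule powr_mult[symmetric])
      also have "\<dots> \<le> real k powr (2 * \<alpha> - 1)"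
        using k True by (intro powr_mono2) auto
      finally show ?thesis .
    next
      case False
      have "real n powr (2 * \<alpha> - 1) \<le> real k powr (2 * \<alpha> - 1)"
        using k False by (intro powr_mono2') auto
      moreover have "0 \<le> real n powr (2 * \<alpha> - 1)" by simp
      ultimately show ?thesis by linarith
    qed
    have "real n powr (2 * \<alpha>) = real n * real n powr (2 * \<alpha> - 1)"
      using n powr_mult_base[of "real n" "2 * \<alpha> - 1"] by simp
    then have "M * real n powr (2 * \<alpha>) = real n / 2 * (4 * M * (real n powr (2 * \<alpha> - 1) / 2))"
      by simp
    also have "\<dots> \<le> real (card {n div 2<..n}) * (4 * M * (real n powr (2 * \<alpha> - 1) / 2))"
      using \<open>M > 0\<close> by (intro mult_right_mono) auto
    also have "\<dots> = (\<Sum>k\<in>{n div 2<..n}. 4 * M * (real n powr (2 * \<alpha> - 1) / 2))" by simp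
    also have "\<dots> \<le> (\<Sum>k\<in>{n div 2<..n}. real (f k))"
    proof (rule sum_mono)
      fix k assume k: "k \<in> {n div 2<..n}"
      have "4 * M * (real n powr (2 * \<alpha> - 1) / 2) \<le> 4 * M * real k powr (2 * \<alpha> - 1)"
        using half[OF k] \<open>M > 0\<close> by (intro mult_left_mono) auto
      also have "\<dots> \<le> real (f k)" using k n by (intro m) auto
      finally show "4 * M * (real n powr (2 * \<alpha> - 1) / 2) \<le> real (f k)" .
    qed
    also have "\<dots> \<le> (\<Sum>k\<in>{1..n}. real (f k))" by (intro sum_mono2) auto
    finally show ?thesis by simp
  qed
  then show ?thesis by (auto simp: eventually_sequentially)
qed

lemma eventually_sum_le:
  fixes f :: "nat \<Rightarrow> nat" and \<delta> :: real
  assumes f: "(\<lambda>n. real (f n)) \<in> o(\<lambda>n. real n)" and "\<delta> > 0"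
  shows "\<forall>\<^sub>F n in sequentially. real (sum f {1..n}) \<le> \<delta> * (real n)\<^sup>2"
proof -
  have "\<forall>\<^sub>F n in sequentially. norm (real (f n)) \<le> (\<delta> / 2) * norm (real n)"
    using f \<open>\<delta> > 0\<close> by (intro landau_o.smallD) auto
  then obtain m where m: "\<And>k. k \<ge> m \<Longrightarrow> real (f k) \<le> \<delta> / 2 * real k"
    by (auto simp: eventually_sequentially)
  define A where "A = real (sum f {1..m})"
  have bound: "real (sum f {1..n}) \<le> A + \<delta> / 2 * (real n)\<^sup>2" for n
  proof -
    have "(\<Sum>k\<in>{1..n}. real (f k)) \<le> (\<Sum>k\<in>{1..m} \<union> {m<..n}. real (f k))"
      by (intro sum_mono2) auto
    also have "\<dots> = A + (\<Sum>k\<in>{m<..n}. real (f k))"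
      by (subst sum.union_disjoint) (auto simp: A_def)
    also have "(\<Sum>k\<in>{m<..n}. real (f k)) \<le> (\<Sum>k\<in>{m<..n}. \<delta> / 2 * real n)"
    proof (rule sum_mono)
      fix k assume k: "k \<in> {m<..n}"
      then have "real (f k) \<le> \<delta> / 2 * real k" by (intro m) auto
      also have "\<dots> \<le> \<delta> / 2 * real n" using k \<open>\<delta> > 0\<close> by (intro mult_left_mono) auto
      finally show "real (f k) \<le> \<delta> / 2 * real n" .
    qed
    also have "\<dots> = real (n - m) * (\<delta> / 2 * real n)" by simp
    also have "\<dots> \<le> real n * (\<delta> / 2 * real n)"
      using \<open>\<delta> > 0\<close> by (intro mult_right_mono) auto
    finally show ?thesis by (simp add: power2_eq_square mult_ac)
  qed
  obtain p :: nat where p: "2 * A / \<delta> \<le> real p" using real_arch_simple by blast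
  have "real (sum f {1..n}) \<le> \<delta> * (real n)\<^sup>2" if "n \<ge> max 1 p" for n
  proof -
    have "A \<le> \<delta> / 2 * real p" using p \<open>\<delta> > 0\<close> by (simp add: field_simps)
    also have "\<dots> \<le> \<delta> / 2 * (real n)\<^sup>2"
    proof (rule mult_left_mono)
      have "real p * 1 \<le> real n * real n" using that by (intro mult_mono) auto
      then show "real p \<le> (real n)\<^sup>2" by (simp add: power2_eq_square)
    qed (use \<open>\<delta> > 0\<close> in simp)
    finally show ?thesis using bound[of n] by simp
  qed
  then show ?thesis by (rule eventually_sequentiallyI)
qed

text \<open>The lower bound keeps the integer \<open>f n\<close> positive, so an upper bound that tends to zero is
  impossible.\<close>

lemma exponent_nonneg:
  fixes f :: "nat \<Rightarrow> nat" and \<alpha> :: real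
  assumes "(\<lambda>n. real (f n)) \<in> O(\<lambda>n. real n powr \<alpha>)"
    and "(\<lambda>n. real (f n)) \<in> \<omega>(\<lambda>n. real n powr (2 * \<alpha> - 1))"
  shows "\<alpha> \<ge> 0"
proof (rule ccontr)
  assume "\<not> \<alpha> \<ge> 0"
  then have "(\<lambda>n. real n powr \<alpha>) \<longlonglongrightarrow> 0"
    by (intro tendsto_neg_powr filterlim_real_sequentially) auto
  then have "(\<lambda>n. real n powr \<alpha>) \<in> o(\<lambda>_. 1)" by (intro smalloI_tendsto) auto
  with assms(1) have "(\<lambda>n. real (f n)) \<in> o(\<lambda>_. 1)"
    by (rule landau_o.big_small_trans)
  then have "\<forall>\<^sub>F n in sequentially. norm (real (f n)) \<le> 1/2 * norm (1::real)"
    by (intro landau_o.smallD) auto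
  moreover have "\<forall>\<^sub>F n in sequentially. norm (real (f n)) \<ge> 1 * norm (real n powr (2 * \<alpha> - 1))"
    using assms(2) by (intro landau_omega.smallD) auto
  moreover have "\<forall>\<^sub>F n in sequentially. n > (0::nat)" by (rule eventually_gt_at_top)
  ultimately have "\<forall>\<^sub>F n in sequentially. False"
  proof eventually_elim
    case (elim n)
    then have "f n = 0" by simp
    moreover have "0 < real n powr (2 * \<alpha> - 1)" using elim by simp
    ultimately show ?case using elim by simp
  qed
  then show False by simp
qed

text \<open>The window of \<open>4t\<close> turns with \<open>t \<approx> \<surd>N\<close> is short compared with \<open>n\<close>, so it sees
  at most \<open>O(\<surd>N n\<^sup>\<alpha>)\<close> new vertices, and \<open>n\<^sup>\<alpha>\<close> is small compared with \<open>\<surd>N\<close>.\<close>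

lemma recent_vertices_negligible:
  fixes f :: "nat \<Rightarrow> nat" and \<alpha> \<epsilon> :: real
  assumes \<alpha>: "\<alpha> < 1" and O: "(\<lambda>n. real (f n)) \<in> O(\<lambda>n. real n powr \<alpha>)"
    and \<omega>: "(\<lambda>n. real (f n)) \<in> \<omega>(\<lambda>n. real n powr (2 * \<alpha> - 1))" and "\<epsilon> > 0"
  shows "\<forall>\<^sub>F n in sequentially. \<exists>t. 4 * t < n \<and> sum f {1..n} \<le> 2 * t * t \<and> 0 < sum f {1..n} \<and>
           real (sum f {n - 4 * t<..n}) \<le> \<epsilon> * real (sum f {1..n})"
proof -
  have "\<alpha> \<ge> 0" using O \<omega> by (rule exponent_nonneg)
  obtain C where "C > 0" and C: "\<forall>\<^sub>F n in sequentially. real (f n) \<le> C * real n powr \<alpha>"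
    using landau_o.bigE[OF O] by auto
  from C obtain m where m: "\<And>k. k \<ge> m \<Longrightarrow> real (f k) \<le> C * real k powr \<alpha>"
    by (auto simp: eventually_sequentially)
  have "(\<lambda>n. real n powr \<alpha>) \<in> o(\<lambda>n. real n powr 1)"
    using \<alpha> by (subst powr_smallo_iff) (auto intro: filterlim_real_sequentially)
  with O have "(\<lambda>n. real (f n)) \<in> o(\<lambda>n. real n powr 1)"
    by (rule landau_o.big_small_trans)
  then have small: "(\<lambda>n. real (f n)) \<in> o(\<lambda>n. real n)" by simp
  define M where "M = (8 * C / \<epsilon>)\<^sup>2"
  have "M > 0" using \<open>C > 0\<close> \<open>\<epsilon> > 0\<close> by (simp add: M_def)
  have "\<forall>\<^sub>F n in sequentially. M * real n powr (2 * \<alpha>) \<le> real (sum f {1..n})"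
    using \<alpha> \<omega> \<open>M > 0\<close> by (rule eventually_sum_ge)
  \<comment> \<open>With \<open>17 * sqrt N \<le> n\<close> and \<open>t \<le> 2 * sqrt N\<close> the window of \<open>4 * t\<close> turns lies in the second
    half of the game, where the bound on \<open>f\<close> applies.\<close>
  moreover have "\<forall>\<^sub>F n in sequentially. real (sum f {1..n}) \<le> 1/289 * (real n)\<^sup>2"
    using small by (rule eventually_sum_le) simp
  moreover have "\<forall>\<^sub>F n in sequentially. n > max 1 (2 * m)" by (rule eventually_gt_at_top)
  ultimately show ?thesis
  proof eventually_elim
    case (elim n)
    define N where "N = real (sum f {1..n})"
    define t where "t = nat \<lceil>sqrt N\<rceil>"
    have "0 < M * real n powr (2 * \<alpha>)" using \<open>M > 0\<close> elim by simp
    then have "0 < N" using elim by (simp only: N_def)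
    then have pos: "0 < sum f {1..n}" unfolding N_def by (simp only: of_nat_0_less_iff)
    then have "real 1 \<le> N" unfolding N_def by (intro of_nat_mono) linarith
    then have "1 \<le> N" by simp
    then have "1 \<le> sqrt N" by simp
    have t: "sqrt N \<le> real t" "real t \<le> 2 * sqrt N"
      using \<open>1 \<le> sqrt N\<close> unfolding t_def by linarith+
    have "sqrt N \<le> sqrt ((real n / 17)\<^sup>2)"
      using elim(2) by (intro real_sqrt_le_mono) (simp add: N_def power_divide)
    then have sqrt_le: "17 * sqrt N \<le> real n" by simp
    have window: "2 * (4 * t) < n" using t(2) sqrt_le \<open>1 \<le> sqrt N\<close> by linarith
    have "N = sqrt N * sqrt N" using \<open>1 \<le> N\<close> by simp
    also have "\<dots> \<le> real t * real t" using t(1) \<open>1 \<le> sqrt N\<close> by (intro mult_mono) auto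
    also have "\<dots> = real (t * t)" by simp
    finally have "sum f {1..n} \<le> t * t" unfolding N_def by (simp only: of_nat_le_iff)
    then have "sum f {1..n} \<le> 2 * t * t" by simp
    moreover have "real (sum f {n - 4 * t<..n}) \<le> \<epsilon> * N"
    proof -
      have "real (sum f {n - 4 * t<..n}) = (\<Sum>k\<in>{n - 4 * t<..n}. real (f k))" by simp
      also have "\<dots> \<le> (\<Sum>k\<in>{n - 4 * t<..n}. C * real n powr \<alpha>)"
      proof (rule sum_mono)
        fix k assume k: "k \<in> {n - 4 * t<..n}"
        then have "real (f k) \<le> C * real k powr \<alpha>" using window elim(3) by (intro m) auto
        also have "\<dots> \<le> C * real n powr \<alpha>"
          using k \<open>C > 0\<close> \<open>\<alpha> \<ge> 0\<close> by (intro mult_left_mono powr_mono2) auto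
        finally show "real (f k) \<le> C * real n powr \<alpha>" .
      qed
      also have "\<dots> = 4 * real t * (C * real n powr \<alpha>)" using window by simp
      also have "\<dots> \<le> 8 * sqrt N * (C * real n powr \<alpha>)"
        using t(2) \<open>C > 0\<close> by (intro mult_right_mono) auto
      also have "\<dots> = \<epsilon> * sqrt N * (8 * C / \<epsilon> * real n powr \<alpha>)"
        using \<open>\<epsilon> > 0\<close> by (simp add: field_simps)
      also have "\<dots> \<le> \<epsilon> * sqrt N * sqrt N"
      proof (rule mult_left_mono)
        have "(8 * C / \<epsilon> * real n powr \<alpha>)\<^sup>2 = M * real n powr (2 * \<alpha>)"
          unfolding M_def power_mult_distrib
          by (simp add: power2_eq_square flip: powr_add)
        then have "(8 * C / \<epsilon> * real n powr \<alpha>)\<^sup>2 \<le> N" using elim(1) by (simp add: N_def)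
        then show "8 * C / \<epsilon> * real n powr \<alpha> \<le> sqrt N" by (rule real_le_rsqrt)
      qed (use \<open>\<epsilon> > 0\<close> \<open>1 \<le> N\<close> in auto)
      also have "\<dots> = \<epsilon> * N" using \<open>1 \<le> N\<close> by (simp add: mult.assoc)
      finally show ?thesis .
    qed
    moreover have "4 * t < n" using window by simp
    moreover note pos
    ultimately show ?case unfolding N_def by blast
  qed
qed

lemma greedy_strategy_winning:
  fixes f :: "nat \<Rightarrow> nat" and \<alpha> :: real
  assumes \<alpha>: "\<alpha> < 1" and O: "(\<lambda>n. real (f n)) \<in> O(\<lambda>n. real n powr \<alpha>)"
    and \<omega>: "(\<lambda>n. real (f n)) \<in> \<omega>(\<lambda>n. real n powr (2 * \<alpha> - 1))"
  shows "arsonist_winning_strategy f greedy_strategy"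
  unfolding arsonist_winning_strategy_def
proof (intro allI impI, elim conjE)
  fix G v
  assume init: "G 0 = empty_ugraph" and greedy: "follows_arsonist greedy_strategy G v"
    and legal: "builder_legal f G"
  have al: "arsonist_legal G v" using greedy_strategy_legal[OF init legal greedy] .
  have le: "card (burning G v n) \<le> sum f {1..n}" for n
    using card_mono[OF finite_pverts[OF init legal] burning_subset_pverts[OF _ al]]
      builder_legal_mono(1)[OF legal] card_pverts[OF init legal]
    by (metis le_add2 plus_1_eq_Suc)
  have "burning_ratio G v \<longlonglongrightarrow> 1"
  proof (rule LIMSEQ_I)
    fix \<epsilon> :: real assume "\<epsilon> > 0"
    then have "\<epsilon> / 2 > 0" by simp
    have "\<forall>\<^sub>F n in sequentially. norm (burning_ratio G v n - 1) < \<epsilon>"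
      using recent_vertices_negligible[OF \<alpha> O \<omega> \<open>\<epsilon> / 2 > 0\<close>]
    proof eventually_elim
      case (elim n)
      then obtain t where t: "4 * t < n" "sum f {1..n} \<le> 2 * t * t" "0 < sum f {1..n}"
        "real (sum f {n - 4 * t<..n}) \<le> \<epsilon> / 2 * real (sum f {1..n})"
        by blast
      define N where "N = real (sum f {1..n})"
      define b where "b = real (card (burning G v n))"
      have "N > 0" using t(3) by (simp only: N_def of_nat_0_less_iff)
      have "N - b = real (sum f {1..n} - card (burning G v n))"
        using le[of n] unfolding N_def b_def by (rule of_nat_diff[symmetric])
      also have "\<dots> \<le> real (sum f {n - 4 * t<..n})"
        unfolding of_nat_le_iff by (rule card_unburned_le[OF init legal greedy t(1,2)])
      also have "\<dots> \<le> \<epsilon> / 2 * N" using t(4) by (simp only: N_def)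
      also have "\<dots> < \<epsilon> * N" using \<open>N > 0\<close> \<open>\<epsilon> > 0\<close> by simp
      finally have "(N - b) / N < \<epsilon>" using \<open>N > 0\<close> by (simp add: divide_less_eq)
      moreover have "b \<le> N" using le[of n] unfolding N_def b_def by (simp only: of_nat_le_iff)
      then have "0 \<le> (N - b) / N" using \<open>N > 0\<close> by simp
      moreover have "burning_ratio G v n = b / N"
        by (simp only: burning_ratio_def b_def N_def card_pverts[OF init legal])
      then have "burning_ratio G v n - 1 = - ((N - b) / N)"
        using \<open>N > 0\<close> by (simp add: diff_divide_distrib)
      ultimately show ?case by simp
    qed
    then show "\<exists>no. \<forall>n\<ge>no. norm (burning_ratio G v n - 1) < \<epsilon>"
      by (simp add: eventually_sequentially)
  qed
  with al show "arsonist_legal G v \<and> arsonist_wins G v" by (simp add: arsonist_wins_def)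
qed

section \<open>The growing path of Builder\<close>

definition path_graph :: "nat \<Rightarrow> ugraph" where
  "path_graph N = \<lparr> pverts = {..<N}, parcs = {(x, y). x < N \<and> y < N \<and> (y = Suc x \<or> x = Suc y)} \<rparr>"

lemma path_graph_simps [simp]:
  "pverts (path_graph N) = {..<N}"
  "parcs (path_graph N) = {(x, y). x < N \<and> y < N \<and> (y = Suc x \<or> x = Suc y)}"
  by (simp_all add: path_graph_def)

lemma pair_graph_path_graph: "pair_graph (path_graph N)"
proof
  have "parcs (path_graph N) \<subseteq> {..<N} \<times> {..<N}" by auto
  then show "finite (parcs (path_graph N))"
    by (rule finite_subset) simp
  show "symmetric (with_proj (path_graph N))"
    by (auto simp: symmetric_def intro!: symI)
qed auto

lemma connected_path_graph:
  assumes "N > 0"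
  shows "Digraph_Component.connected (with_proj (path_graph N))"
proof -
  interpret pair_graph "path_graph N" by (rule pair_graph_path_graph)
  have "(parcs (path_graph N))\<^sup>s = parcs (path_graph N)"
    by (auto simp: symcl_def)
  have up: "(0, x) \<in> rtrancl_on {..<N} (parcs (path_graph N))" if "x < N" for x
    using that
  proof (induction x)
    case (Suc x)
    then have "(0, x) \<in> rtrancl_on {..<N} (parcs (path_graph N))" "(x, Suc x) \<in> parcs (path_graph N)"
      by auto
    with Suc.prems show ?case by (auto intro: rtrancl_on_into_rtrancl_on)
  qed simp
  have down: "(x, 0) \<in> rtrancl_on {..<N} (parcs (path_graph N))" if "x < N" for x
    using that
  proof (induction x)
    case (Suc x)
    then have "(x, 0) \<in> rtrancl_on {..<N} (parcs (path_graph N))" "(Suc x, x) \<in> parcs (path_graph N)"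
      by auto
    with Suc.prems show ?case by (intro converse_rtrancl_on_into_rtrancl_on[of "Suc x" x]) auto
  qed simp
  show ?thesis
    unfolding connected_conv with_proj_simps \<open>(parcs (path_graph N))\<^sup>s = _\<close>
    using assms up down by (auto intro: rtrancl_on_trans)
qed

lemma builder_move_path_graph:
  assumes "N' = N + k"
  shows "builder_move k (path_graph N) (path_graph N')"
proof -
  have "{..<N'} - {..<N} = {N..<N'}" by auto
  then show ?thesis
    using assms pair_graph_path_graph connected_path_graph[of N'] unfolding builder_move_def
    by (cases "N' = 0") auto
qed

text \<open>
  On a path the fire moves by one position per turn in each direction.  So what burns after \<open>T\<close>
  further turns lies in the old part extended by \<open>T\<close> vertices, or in one of \<open>T\<close> intervals of
  length less than \<open>2T\<close> around the new sources.
\<close>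

lemma card_burning_path_le:
  assumes G: "\<And>n. G n = path_graph (F n)"
    and old: "burning G v m \<subseteq> {..<F m}"
  shows "card (burning G v (m + T)) \<le> F m + T + 2 * T * T"
proof -
  define J where "J T i = (\<Union>a\<in>set_option (v i). {a - (m + T - i)..a + (m + T - i)})" for T i
  have cover: "burning G v (m + T) \<subseteq> {..<F m + T} \<union> (\<Union>i\<in>{m<..m + T}. J T i)" for T
  proof (induction T)
    case 0
    with old show ?case by simp
  next
    case (Suc T)
    show ?case
    proof
      fix w assume "w \<in> burning G v (m + Suc T)"
      then consider (source) "v (Suc (m + T)) = Some w"
        | (spread) u where "u \<in> burning G v (m + T)" "w = u \<or> w = Suc u \<or> u = Suc w"
        by (auto simp: G spread_def)
      then show "w \<in> {..<F m + Suc T} \<union> (\<Union>i\<in>{m<..m + Suc T}. J (Suc T) i)"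
      proof cases
        case source
        then have "w \<in> J (Suc T) (m + Suc T)" by (simp add: J_def)
        then show ?thesis by fastforce
      next
        case spread
        from spread(1) Suc.IH consider (old) "u < F m + T"
          | (new) i where "i \<in> {m<..m + T}" "u \<in> J T i"
          by auto
        then show ?thesis
        proof cases
          case old
          with spread(2) show ?thesis by auto
        next
          case new
          from new have "m + Suc T - i = Suc (m + T - i)" by auto
          with new(2) spread(2) have "w \<in> J (Suc T) i" by (auto simp: J_def)
          moreover have "i \<in> {m<..m + Suc T}" using new(1) by auto
          ultimately show ?thesis by blast
        qed
      qed
    qed
  qed
  have fin: "finite (J T i)" for i by (simp add: J_def)
  have J: "card (J T i) \<le> 2 * T" if "i \<in> {m<..m + T}" for i
    using that by (cases "v i") (auto simp: J_def)
  have "card (burning G v (m + T)) \<le> card ({..<F m + T} \<union> (\<Union>i\<in>{m<..m + T}. J T i))"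
    using fin by (intro card_mono cover) auto
  also have "\<dots> \<le> card {..<F m + T} + card (\<Union>i\<in>{m<..m + T}. J T i)"
    by (rule card_Un_le)
  also have "card (\<Union>i\<in>{m<..m + T}. J T i) \<le> (\<Sum>i\<in>{m<..m + T}. card (J T i))"
    by (rule card_UN_le) simp
  also have "\<dots> \<le> (\<Sum>i\<in>{m<..m + T}. 2 * T)" by (rule sum_mono) (rule J)
  finally show ?thesis by (simp add: mult_ac)
qed

definition path_strategy :: "(nat \<Rightarrow> nat) \<Rightarrow> builder_strategy" where
  "path_strategy f Gs vs = path_graph (sum f {1..Suc (length Gs)})"

lemma path_strategy_winning:
  fixes f :: "nat \<Rightarrow> nat"
  assumes f: "(\<lambda>n. real (f n)) \<in> \<Omega>(\<lambda>n. real n)"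
  shows "builder_winning_strategy f (path_strategy f)"
  unfolding builder_winning_strategy_def
proof (intro allI impI, elim conjE)
  fix G v
  assume init: "G 0 = empty_ugraph" and follows: "follows_builder (path_strategy f) G v"
    and al: "arsonist_legal G v"
  define F where "F n = sum f {1..n}" for n
  have G: "G n = path_graph (F n)" for n
  proof (cases n)
    case 0
    then show ?thesis by (simp add: init empty_ugraph_def path_graph_def F_def)
  next
    case (Suc m)
    then show ?thesis
      using follows by (simp add: follows_builder_def path_strategy_def F_def del: sum.cl_ivl_Suc)
  qed
  have "builder_move (f n) (G (n - 1)) (G n)" if "n \<ge> 1" for n
    using that unfolding G by (intro builder_move_path_graph) (cases n; simp add: F_def)
  then have legal: "builder_legal f G" by (simp add: builder_legal_def)
  have "burning G v m \<subseteq> pverts (G m)" for m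
    using al by (rule burning_subset_pverts[rotated]) (simp add: G F_def)
  then have sub: "burning G v m \<subseteq> {..<F m}" for m by (simp add: G)
  have card_le: "card (burning G v (m + T)) \<le> F m + T + 2 * T * T" for m T
    using G sub by (rule card_burning_path_le)

  obtain c0 where "c0 > 0" and c0: "\<forall>\<^sub>F n in sequentially. c0 * real n \<le> real (f n)"
    using landau_omega.bigE[OF f] by auto
  define c where "c = min 1 c0"
  have c: "0 < c" "c \<le> 1" using \<open>c0 > 0\<close> by (auto simp: c_def)
  from c0 obtain n0 where n0: "\<And>k. k \<ge> n0 \<Longrightarrow> c0 * real k \<le> real (f k)"
    by (auto simp: eventually_sequentially)
  have f_ge: "c * real k \<le> real (f k)" if "k \<ge> n0" for k
  proof -
    have "c * real k \<le> c0 * real k" by (intro mult_right_mono) (auto simp: c_def)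
    with n0[OF that] show ?thesis by simp
  qed
  obtain n1 :: nat where n1: "16 / c \<le> real n1" using real_arch_simple by blast
  define \<eta> where "\<eta> = c\<^sup>2 / 768"
  have \<eta>: "0 < \<eta>" "\<eta> \<le> 1/2"
    using c power_le_one[of c 2] by (auto simp: \<eta>_def)
  have ratio: "burning_ratio G v n \<le> 1 - \<eta>" if n: "n \<ge> max 1 (max (2 * n0) n1)" for n
  proof -
    define b where "b = real (card (burning G v n))"
    have "F n > 0"
    proof -
      have "0 < c * real n" using c n by simp
      also have "\<dots> \<le> real (f n)" using n by (intro f_ge) auto
      also have "\<dots> \<le> real (F n)" using n unfolding F_def by (simp del: of_nat_sum) (intro member_le_sum; simp)
      finally show ?thesis by simp
    qed
    have "b \<le> (1 - \<eta>) * real (F n)"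
    proof (cases "6 * n * n \<le> F n")
      case True
      have "card (burning G v n) \<le> n + 2 * n * n" using card_le[of 0 n] by (simp add: F_def)
      also have "\<dots> \<le> 3 * n * n" using n by simp
      finally have "2 * card (burning G v n) \<le> F n" using True by simp
      then have "b \<le> 1/2 * real (F n)" unfolding b_def by linarith
      also have "\<dots> \<le> (1 - \<eta>) * real (F n)" using \<eta> by (intro mult_right_mono) auto
      finally show ?thesis .
    next
      case False
      \<comment> \<open>With \<open>T \<le> c n / 8\<close> the vertices added in the window, at least \<open>c n T / 2\<close>, outnumber
        the \<open>2T\<^sup>2 + T\<close> that can burn; the lower bound on \<open>T\<close> makes the surplus quadratic in \<open>n\<close>.\<close>
      define T where "T = nat \<lfloor>c * real n / 8\<rfloor>"
      have cn: "16 \<le> c * real n"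
      proof -
        have "16 / c \<le> real n" using n1 n by linarith
        then show ?thesis using c by (simp add: field_simps)
      qed
      have T: "real T \<le> c * real n / 8" "c * real n / 16 \<le> real T"
        using cn unfolding T_def by linarith+
      have "c * real n \<le> real n" using c n mult_right_mono[of c 1 "real n"] by simp
      then have half: "2 * T \<le> n" using T(1) by linarith
      define m where "m = n - T"
      have nm: "n = m + T" using half by (simp add: m_def)
      have "real T * (c * real n / 2) = (\<Sum>k\<in>{m<..n}. c * real n / 2)"
        by (simp add: nm)
      also have "\<dots> \<le> (\<Sum>k\<in>{m<..n}. real (f k))"
      proof (rule sum_mono)
        fix k assume k: "k \<in> {m<..n}"
        have "c * (real n / 2) \<le> c * real k"
          using k c half by (intro mult_left_mono) (auto simp: m_def)
        also have "\<dots> \<le> real (f k)" using k half n by (intro f_ge) (auto simp: m_def)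
        finally show "c * real n / 2 \<le> real (f k)" by simp
      qed
      finally have window: "real T * (c * real n / 2) \<le> (\<Sum>k\<in>{m<..n}. real (f k))" .
      have added: "real T * (c * real n / 2) \<le> real (F n) - real (F m)"
      proof -
        have "F n = F m + sum f {m<..n}"
          unfolding F_def by (rule sum_split_turn) (simp add: nm)
        then show ?thesis using window by simp
      qed
      have "b \<le> real (F m + T + 2 * T * T)"
        using card_le[of m T] unfolding b_def nm by (rule of_nat_mono)
      then have "b \<le> real (F m) + real T + 2 * real T * real T" by simp
      moreover have "real T * (c * real n / 8) \<le> real T * (c * real n / 2 - 1 - 2 * real T)"
        using T(1) cn by (intro mult_left_mono) auto
      moreover have "c * real n / 16 * (c * real n / 8) \<le> real T * (c * real n / 8)"
        using T(2) cn by (intro mult_right_mono) auto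
      ultimately have "b \<le> real (F n) - c\<^sup>2 * (real n)\<^sup>2 / 128"
        using added by (simp add: algebra_simps power2_eq_square)
      moreover have "\<eta> * real (F n) \<le> \<eta> * (6 * (real n)\<^sup>2)"
      proof (rule mult_left_mono)
        have "real (F n) \<le> real (6 * n * n)" using False by (intro of_nat_mono) simp
        then show "real (F n) \<le> 6 * (real n)\<^sup>2" by (simp add: power2_eq_square)
      qed (use \<eta> in simp)
      moreover have "\<eta> * (6 * (real n)\<^sup>2) = c\<^sup>2 * (real n)\<^sup>2 / 128" by (simp add: \<eta>_def)
      ultimately show ?thesis by (simp add: algebra_simps)
    qed
    then show ?thesis
      using \<open>F n > 0\<close> by (simp add: burning_ratio_def G b_def field_simps)
  qed
  have "upper_density G v \<le> ereal (1 - \<eta>)"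
    unfolding upper_density_def
    using ratio by (intro Limsup_bounded eventually_sequentiallyI) (simp only: ereal_less_eq)
  also have "\<dots> < 1" using \<eta> by simp
  finally have "builder_wins G v" by (simp add: builder_wins_def)
  with legal show "builder_legal f G \<and> builder_wins G v" by simp
qed

theorem theorem2:
  fixes f :: "nat \<Rightarrow> nat"
  shows "((\<exists>\<alpha>::real. \<alpha> < 1 \<and>
             (\<lambda>n. real (f n)) \<in> O(\<lambda>n. real n powr \<alpha>) \<and>
             (\<lambda>n. real (f n)) \<in> \<omega>(\<lambda>n. real n powr (2 * \<alpha> - 1)))
           \<longrightarrow> (\<exists>\<tau>. arsonist_winning_strategy f \<tau>))
       \<and> ((\<lambda>n. real (f n)) \<in> \<Omega>(\<lambda>n. real n)
           \<longrightarrow> (\<exists>\<sigma>. builder_winning_strategy f \<sigma>))"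
  using greedy_strategy_winning path_strategy_winning by blast

end
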